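(* Let $(\lambda,v)$ be an eigenpair of $M$ with $c^Hv=1$, let $\sigma\in\Omega$ with $M(\sigma)$ invertible, let $w_\sigma^H=c^HM(\sigma)^{-1}$, and assume $w_\sigma^HM'(\lambda)v\neq0$. Put $\alpha=(w_\sigma^HM'(\lambda)v)^{-1}$, $q=M(\sigma)^{-1}M'(\lambda)v$ and $$A_2=\begin{bmatrix} (I-\alpha qc^H)M(\sigma)^{-1}\left[M(\sigma)-M(\lambda)\right] & 0\\ \alpha c^HM(\sigma)^{-1}\left(M(\sigma)-M(\lambda)\right) & 0\end{bmatrix}.$$ Then the non-zero eigenvalues of $A_2$ are the same as the non-zero eigenvalues of $$B=(I-vc^H)M(\sigma)^{-1}\left[M(\sigma)-M(\lambda)+\frac{1}{w_\sigma^HM'(\lambda)v}M'(\lambda)v\,w_\sigma^HM(\lambda)\right],$$ and the convergence factors of QN2 and QN3 (as defined in the context) are the same.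
   Context: $\Omega\subset\mathbb{C}$ is a closed set, and $M:\Omega\to\mathbb{C}^{n\times n}$ is analytic (holomorphic) in $\Omega$. An eigenpair is $(\lambda,v)$ with $\lambda\in\Omega$, $v\ne0$, $M(\lambda)v=0$. The vector $c\in\mathbb{C}^n$ is a fixed normalization vector; the superscript $H$ denotes conjugate transpose. The (local) convergence factor of an iteration at $(\lambda,v)$ is the spectral radius of the matrix describing the first-order propagation of the error, i.e. of the derivative of the one-step fixed-point map at the solution. QN2 is the quasi-Newton iteration $$\begin{bmatrix}M(\sigma)&M'(\mu_k)x_k\\ c^H&0\end{bmatrix}\begin{bmatrix}x_{k+1}-x_k\\ \mu_{k+1}-\mu_k\end{bmatrix}=-\begin{bmatrix}M(\mu_k)x_k\\ c^Hx_k-1\end{bmatrix},$$ with fixed-point map $(x_k,\mu_k)\mapsto(x_{k+1},\mu_{k+1})$ near $(v,\lambda)$. QN3 is the analogous iteration with (1,2)-block $M[\mu_{k+1},\mu_k]x_k$, where $M[\lambda,\mu]=\frac{M(\lambda)-M(\mu)}{\lambda-\mu}$ for $\lambda\ne\mu$ and $M[\lambda,\lambda]=M'(\lambda)$. It is equivalent to residual inverse iteration with normalized iterates: given $x_k$ near $v$, let $\mu_{k+1}$ be the solution near $\lambda$ of $w_\sigma^HM(\mu_{k+1})x_k=0$, compute $\hat x_{k+1}=x_k-M(\sigma)^{-1}M(\mu_{k+1})x_k$ and take $x_{k+1}=\hat x_{k+1}/(c^H\hat x_{k+1})$ (this normalization changes nothing when $c^Hx_k=1$). The convergence factor of QN3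 is the spectral radius of the derivative at $v$ of this map $x_k\mapsto x_{k+1}$. *)

theory Defs
  imports "HOL-Analysis.Analysis"
begin

(* Row vectors r (such as c^H and c^H M(sigma)^{-1}) are kept as elements of complex^'n that already
   carry the conjugation, so row_col is bilinear and outer u r is the rank-one matrix u r. *)

definition herm :: "complex^'n \<Rightarrow> complex^'n" where
  "herm c = (\<chi> i. cnj (c $ i))"

definition row_col :: "complex^'n \<Rightarrow> complex^'n \<Rightarrow> complex" where
  "row_col r x = (\<Sum>i\<in>UNIV. r $ i * x $ i)"

definition outer :: "complex^'m \<Rightarrow> complex^'n \<Rightarrow> complex^'n^'m" where
  "outer u r = (\<chi> i j. u $ i * r $ j)"

(* C^(n+1) is indexed by 'n + unit. *)

definition block_vec :: "complex^'n \<Rightarrow> complex \<Rightarrow> complex^('n::finite + unit)" where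
  "block_vec x \<mu> = (\<chi> i. case i of Inl k \<Rightarrow> x $ k | Inr _ \<Rightarrow> \<mu>)"

definition top_part :: "complex^('n::finite + unit) \<Rightarrow> complex^'n" where
  "top_part z = (\<chi> k. z $ Inl k)"

definition bot_part :: "complex^('n::finite + unit) \<Rightarrow> complex" where
  "bot_part z = z $ Inr ()"

definition block_mat ::
    "complex^'n^'n \<Rightarrow> complex^'n \<Rightarrow> complex^'n \<Rightarrow> complex \<Rightarrow> complex^('n::finite + unit)^('n::finite + unit)" where
  "block_mat A b r d = (\<chi> i j. case i of
       Inl k \<Rightarrow> (case j of Inl l \<Rightarrow> A $ k $ l | Inr _ \<Rightarrow> b $ k)
     | Inr _ \<Rightarrow> (case j of Inl l \<Rightarrow> r $ l | Inr _ \<Rightarrow> d))"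

definition eigenvalue :: "complex^'m^'m \<Rightarrow> complex \<Rightarrow> bool" where
  "eigenvalue A z \<longleftrightarrow> (\<exists>x. x \<noteq> 0 \<and> A *v x = z *s x)"

definition spectral_radius :: "complex^'m^'m \<Rightarrow> real" where
  "spectral_radius A = Max (cmod ` {z. eigenvalue A z})"

definition mat_analytic_on :: "(complex \<Rightarrow> complex^'n^'m) \<Rightarrow> complex set \<Rightarrow> bool" where
  "mat_analytic_on M S \<longleftrightarrow> (\<forall>i j. (\<lambda>z. M z $ i $ j) analytic_on S)"

definition mat_deriv :: "(complex \<Rightarrow> complex^'n^'m) \<Rightarrow> complex \<Rightarrow> complex^'n^'m" where
  "mat_deriv M z = (\<chi> i j. deriv (\<lambda>w. M w $ i $ j) z)"

definition eigenpair ::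
    "complex set \<Rightarrow> (complex \<Rightarrow> complex^'n^'n) \<Rightarrow> complex \<Rightarrow> complex^'n \<Rightarrow> bool" where
  "eigenpair \<Omega> M l v \<longleftrightarrow> l \<in> \<Omega> \<and> v \<noteq> 0 \<and> M l *v v = 0"

(* The one-step maps are only defined near the solution p, so an iteration is given by the predicate
   is_map singling out the functions that realise it near p. The iteration has convergence factor rho
   if such a function exists and every one of them fixes p and has there a derivative, given by a
   complex matrix of spectral radius rho. *)

definition has_convergence_factor ::
    "((complex^'m \<Rightarrow> complex^'m) \<Rightarrow> bool) \<Rightarrow> complex^'m \<Rightarrow> real \<Rightarrow> bool" where
  "has_convergence_factor is_map p \<rho> \<longleftrightarrow>
     (\<exists>G. is_map G) \<and>
     (\<forall>G. is_map G \<longrightarrow>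
        G p = p \<and> (\<exists>A. (G has_derivative (\<lambda>h. A *v h)) (at p) \<and> \<rho> = spectral_radius A))"

definition qn2_step ::
    "(complex \<Rightarrow> complex^'n^'n) \<Rightarrow> complex^'n \<Rightarrow> complex \<Rightarrow>
     complex^'n \<Rightarrow> complex \<Rightarrow> complex^'n \<Rightarrow> complex \<Rightarrow> bool" where
  "qn2_step M c \<sigma> x \<mu> x' \<mu>' \<longleftrightarrow>
     block_mat (M \<sigma>) (mat_deriv M \<mu> *v x) (herm c) 0 *v block_vec (x' - x) (\<mu>' - \<mu>)
       = - block_vec (M \<mu> *v x) (row_col (herm c) x - 1)"

definition qn2_map ::
    "(complex \<Rightarrow> complex^'n^'n) \<Rightarrow> complex^'n \<Rightarrow> complex \<Rightarrow> complex \<Rightarrow> complex^'n \<Rightarrow>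
     (complex^('n::finite + unit) \<Rightarrow> complex^('n::finite + unit)) \<Rightarrow> bool" where
  "qn2_map M c \<sigma> l v G \<longleftrightarrow>
     (\<forall>\<^sub>F z in nhds (block_vec v l). \<forall>z'.
        qn2_step M c \<sigma> (top_part z) (bot_part z) (top_part z') (bot_part z') \<longleftrightarrow> z' = G z)"

(* For x near v, m x is "the solution near l" of P x mu: the only one in some fixed neighbourhood
   of l, and tending to l as x tends to v (nhds includes the point v itself, so m v = l). *)

definition solution_near ::
    "('a::topological_space \<Rightarrow> 'b::topological_space \<Rightarrow> bool) \<Rightarrow> 'a \<Rightarrow> 'b \<Rightarrow> ('a \<Rightarrow> 'b) \<Rightarrow> bool" where
  "solution_near P v l m \<longleftrightarrow>
     (m \<longlongrightarrow> l) (nhds v) \<and>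
     (\<exists>V. open V \<and> l \<in> V \<and> (\<forall>\<^sub>F x in nhds v. \<forall>\<mu>. \<mu> \<in> V \<and> P x \<mu> \<longleftrightarrow> \<mu> = m x))"

definition w_row :: "(complex \<Rightarrow> complex^'n^'n) \<Rightarrow> complex^'n \<Rightarrow> complex \<Rightarrow> complex^'n" where
  "w_row M c \<sigma> = herm c v* matrix_inv (M \<sigma>)"

(* QN3 in its form as residual inverse iteration with normalized iterates. *)

definition qn3_map ::
    "(complex \<Rightarrow> complex^'n^'n) \<Rightarrow> complex^'n \<Rightarrow> complex \<Rightarrow> complex \<Rightarrow> complex^'n \<Rightarrow>
     (complex^'n \<Rightarrow> complex^'n) \<Rightarrow> bool" where
  "qn3_map M c \<sigma> l v G \<longleftrightarrow>
     (\<exists>m. solution_near (\<lambda>x \<mu>. row_col (w_row M c \<sigma>) (M \<mu> *v x) = 0) v l m \<and>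
        (\<forall>\<^sub>F x in nhds v.
           let xh = x - matrix_inv (M \<sigma>) *v (M (m x) *v x)
           in G x = (1 / row_col (herm c) xh) *s xh))"

end

theory Submission
  imports Defs "HOL-Complex_Analysis.Cauchy_Integral_Formula"
begin

text \<open>
  Write \<open>N\<close> for the inverse of \<open>M \<sigma>\<close> and \<open>r\<close> for the row vector \<open>herm c\<close>, so that \<open>w = r N\<close>, and put
  \<open>D = I - N M(l) + \<alpha> q w M(l)\<close>. Both matrices of the theorem are deflations of \<open>D\<close> by a rank-one
  matrix with the same row \<open>r\<close>: the upper left block of \<open>A2\<close> is \<open>D - \<alpha> q r\<close>, and \<open>B = D - v r\<close>.
  Since \<open>r q = w M'(l) v = 1/\<alpha>\<close>, the row \<open>r\<close> is a left eigenvector of \<open>D\<close> for the eigenvalue 1, and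
  \<open>r (\<alpha> q) = r v = 1\<close>. Hence \<open>r\<close> annihilates both deflated matrices from the left, so their
  eigenvectors for nonzero eigenvalues lie in the kernel of \<open>r\<close>, where both matrices agree with \<open>D\<close>
  (\<open>eigenvalue_deflation\<close>). The zero last column of \<open>A2\<close> contributes only the eigenvalue 0
  (\<open>eigenvalue_block_lower\<close>). As \<open>B v = 0\<close>, the number 0 is an eigenvalue of both matrices, and so
  the full spectra, and the spectral radii, coincide.

  It remains to identify \<open>A2\<close> and \<open>B\<close> as the derivatives of the two iterations. One QN2 step can be
  solved explicitly by block elimination as long as \<open>w M'(\<mu>) x \<noteq> 0\<close>, which holds near the solution;
  differentiating the resulting formula gives \<open>A2\<close> (\<open>qn2_convergence_factor\<close>). For QN3, the inner
  equation \<open>w M(\<mu>) x = 0\<close> defines \<open>\<mu>\<close> as a differentiable function of \<open>x\<close>, because its derivative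
  in \<open>\<mu>\<close> at the solution is \<open>w M'(l) v \<noteq> 0\<close> (\<open>implicit_function\<close>). The unnormalized step then has
  derivative \<open>D\<close>, and the normalization multiplies it by \<open>I - v r\<close>, which gives
  \<open>D - v r D = D - v r = B\<close> (\<open>qn3_convergence_factor\<close>).
\<close>

section \<open>Row vectors, rank-one matrices and block matrices\<close>

lemma outer_vector_mult: "outer u r *v x = row_col r x *s u"
  by (simp add: outer_def row_col_def matrix_vector_mult_def vec_eq_iff sum_distrib_right
      sum_distrib_left algebra_simps)

lemma row_col_vector_matrix: "row_col (r v* A) x = row_col r (A *v x)"
proof -
  have "row_col (r v* A) x = (\<Sum>j\<in>UNIV. \<Sum>i\<in>UNIV. r $ i * (A $ i $ j * x $ j))"
    by (simp add: row_col_def vector_matrix_mult_def sum_distrib_right sum_distrib_left algebra_simps)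
  also have "\<dots> = (\<Sum>i\<in>UNIV. \<Sum>j\<in>UNIV. r $ i * (A $ i $ j * x $ j))"
    by (rule sum.swap)
  finally show ?thesis
    by (simp add: row_col_def matrix_vector_mult_def sum_distrib_left)
qed

lemma row_col_left_scale: "row_col (a *s r) x = a * row_col r x"
  by (simp add: row_col_def sum_distrib_left algebra_simps)

lemma row_col_add: "row_col r (x + y) = row_col r x + row_col r y"
  and row_col_diff: "row_col r (x - y) = row_col r x - row_col r y"
  and row_col_minus: "row_col r (- x) = - row_col r x"
  and row_col_scale: "row_col r (a *s x) = a * row_col r x"
  and row_col_zero: "row_col r 0 = 0"
  by (simp_all add: row_col_def sum.distrib sum_subtractf sum_negf sum_distrib_left algebra_simps)

lemmas row_col_linear = row_col_add row_col_diff row_col_minus row_col_scale row_col_zero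

lemma top_part_block_vec [simp]: "top_part (block_vec x a) = x"
  and bot_part_block_vec [simp]: "bot_part (block_vec x a) = a"
  and block_vec_parts [simp]: "block_vec (top_part z) (bot_part z) = z"
  by (auto simp: top_part_def bot_part_def block_vec_def vec_eq_iff split: sum.split)

lemma block_vec_eq_iff: "block_vec x a = block_vec y b \<longleftrightarrow> x = y \<and> a = b"
  by (metis top_part_block_vec bot_part_block_vec)

lemma block_vec_minus: "- block_vec x a = block_vec (- x) (- a)"
  and block_vec_scale: "b *s block_vec x a = block_vec (b *s x) (b * a)"
  and block_vec_zero: "block_vec 0 0 = 0"
  by (auto simp: block_vec_def vec_eq_iff split: sum.split)

lemma block_mat_mult_block_vec:
  "block_mat A b r d *v block_vec x a = block_vec (A *v x + a *s b) (row_col r x + d * a)"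
proof -
  have split: "(\<Sum>j\<in>UNIV. f j) = (\<Sum>k\<in>UNIV. f (Inl k)) + f (Inr ())"
    for f :: "'n::finite + unit \<Rightarrow> complex"
    by (simp add: UNIV_Plus_UNIV[symmetric] sum.Plus UNIV_unit)
  show ?thesis
    by (auto simp: vec_eq_iff matrix_vector_mult_def block_mat_def block_vec_def row_col_def split
        mult.commute split: sum.split)
qed

lemma matrix_inv_mult_cancel:
  fixes A :: "complex^'n^'n"
  assumes "invertible A"
  shows "A *v (matrix_inv A *v x) = x" and "matrix_inv A *v (A *v x) = x"
proof -
  have "A ** matrix_inv A = mat 1 \<and> matrix_inv A ** A = mat 1"
    using assms unfolding invertible_def matrix_inv_def by (rule someI_ex)
  then show "A *v (matrix_inv A *v x) = x" "matrix_inv A *v (A *v x) = x"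
    by (simp_all add: matrix_vector_mul_assoc)
qed

lemma matrix_vector_mult_scale: "A *v (a *s x) = a *s (A *v (x :: complex^'n))"
  by (simp add: matrix_vector_mult_def vec_eq_iff sum_distrib_left algebra_simps)

section \<open>Spectra\<close>

text \<open>
  For \<open>z \<noteq> 0\<close> the last component of an eigenvector is determined by the others: it is
  \<open>row_col s x / z\<close>. In particular an eigenvector with \<open>x = 0\<close> cannot occur.
\<close>

lemma eigenvalue_block_lower:
  assumes "z \<noteq> 0"
  shows "eigenvalue (block_mat T 0 s 0) z \<longleftrightarrow> eigenvalue T z"
proof
  assume "eigenvalue (block_mat T 0 s 0) z"
  then obtain y where y: "y \<noteq> 0" "block_mat T 0 s 0 *v y = z *s y"
    unfolding eigenvalue_def by blast
  obtain x a where y_eq: "y = block_vec x a"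
    by (metis block_vec_parts)
  have "T *v x = z *s x" "row_col s x = z * a"
    using y(2) by (simp_all add: y_eq block_mat_mult_block_vec block_vec_scale block_vec_eq_iff)
  moreover have "x \<noteq> 0"
    using calculation(2) assms y(1) by (auto simp: y_eq block_vec_zero row_col_linear)
  ultimately show "eigenvalue T z"
    unfolding eigenvalue_def by blast
next
  assume "eigenvalue T z"
  then obtain x where x: "x \<noteq> 0" "T *v x = z *s x"
    unfolding eigenvalue_def by blast
  have "block_mat T 0 s 0 *v block_vec x (row_col s x / z) = z *s block_vec x (row_col s x / z)"
    using assms x(2) by (simp add: block_mat_mult_block_vec block_vec_scale)
  moreover have "block_vec x (row_col s x / z) \<noteq> 0"
    using x(1) by (metis block_vec_eq_iff block_vec_zero)
  ultimately show "eigenvalue (block_mat T 0 s 0) z"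
    unfolding eigenvalue_def by blast
qed

lemma eigenvalue_block_last_column_zero: "eigenvalue (block_mat T 0 s 0) 0"
proof -
  have "block_mat T 0 s 0 *v block_vec 0 1 = 0 *s block_vec 0 1"
    by (simp add: block_mat_mult_block_vec row_col_linear block_vec_zero)
  moreover have "block_vec (0 :: complex^'a) 1 \<noteq> 0"
    by (metis block_vec_eq_iff block_vec_zero zero_neq_one)
  ultimately show ?thesis
    unfolding eigenvalue_def by blast
qed

text \<open>
  Multiplying the eigenvalue equation by \<open>r\<close> from the left gives \<open>z * row_col r x = 0\<close>, since
  \<open>r (D - u r) = r - r = 0\<close>. The right-hand side of the equivalence is free of \<open>u\<close>, which is what
  makes it possible to exchange one deflation vector for another.
\<close>

lemma eigenvector_deflation:
  fixes D :: "complex^'n^'n"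
  assumes "r v* D = r" and "row_col r u = 1" and "z \<noteq> 0"
  shows "(D - outer u r) *v x = z *s x \<longleftrightarrow> row_col r x = 0 \<and> D *v x = z *s x"
proof
  assume eq: "(D - outer u r) *v x = z *s x"
  have "z * row_col r x = row_col r ((D - outer u r) *v x)"
    by (simp add: eq row_col_linear)
  also have "\<dots> = row_col (r v* D) x - row_col r x * row_col r u"
    by (simp add: matrix_vector_mult_diff_rdistrib outer_vector_mult row_col_linear
        row_col_vector_matrix)
  also have "\<dots> = 0"
    using assms by simp
  finally have "row_col r x = 0"
    using assms by simp
  then show "row_col r x = 0 \<and> D *v x = z *s x"
    using eq by (simp add: matrix_vector_mult_diff_rdistrib outer_vector_mult)
qed (simp add: matrix_vector_mult_diff_rdistrib outer_vector_mult)

lemma eigenvalue_deflation: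
  fixes D :: "complex^'n^'n"
  assumes "r v* D = r" and "row_col r u = 1" and "row_col r u' = 1" and "z \<noteq> 0"
  shows "eigenvalue (D - outer u r) z \<longleftrightarrow> eigenvalue (D - outer u' r) z"
  unfolding eigenvalue_def using assms by (simp add: eigenvector_deflation)

section \<open>Differentiability of vector and matrix functions\<close>

lemma has_derivative_vec:
  fixes f :: "'a::real_normed_vector \<Rightarrow> 'b::euclidean_space^'n"
  assumes "\<And>i. ((\<lambda>x. f x $ i) has_derivative (\<lambda>h. f' h $ i)) (at a within S)"
  shows "(f has_derivative f') (at a within S)"
  unfolding has_derivative_componentwise_within[of f]
  using assms by (auto simp: Basis_vec_def inner_axis intro!: has_derivative_inner_left)

lemma bounded_linear_row_col: "bounded_linear (row_col (r :: complex^'n))"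
  by (rule linear_conv_bounded_linear[THEN iffD1], rule linearI)
    (simp_all add: row_col_add row_col_def[of r "_ *\<^sub>R _"] row_col_def[of r] scaleR_sum_right)

lemma bounded_bilinear_matrix_vector_mult:
  "bounded_bilinear ((*v) :: complex^'n^'m \<Rightarrow> complex^'n \<Rightarrow> complex^'m)"
proof -
  have "linear (\<lambda>A. A *v x)" for x :: "complex^'n"
    by (rule linearI)
      (simp_all add: matrix_vector_mult_def vec_eq_iff scaleR_sum_right sum.distrib distrib_right)
  then show ?thesis
    by (auto simp: bilinear_conv_bounded_bilinear[symmetric] bilinear_def)
qed

lemma bounded_bilinear_vector_scale:
  "bounded_bilinear ((*s) :: complex \<Rightarrow> complex^'n \<Rightarrow> complex^'n)"
proof -
  have "linear (\<lambda>a. a *s x)" "linear (\<lambda>y. a *s y)" for x :: "complex^'n" and a :: complex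
    by (rule linearI; simp add: vec_eq_iff algebra_simps)+
  then show ?thesis
    by (auto simp: bilinear_conv_bounded_bilinear[symmetric] bilinear_def)
qed

lemma bounded_linear_top_part: "bounded_linear (top_part :: complex^('n::finite + unit) \<Rightarrow> _)"
  and bounded_linear_bot_part: "bounded_linear (bot_part :: complex^('n::finite + unit) \<Rightarrow> _)"
  by (rule linear_conv_bounded_linear[THEN iffD1], rule linearI;
      simp add: top_part_def bot_part_def vec_eq_iff)+

lemma has_derivative_block_vec:
  fixes f f' :: "'a::real_normed_vector \<Rightarrow> complex^('n::finite)"
  assumes "(f has_derivative f') (at a)" and "(g has_derivative g') (at a)"
  shows "((\<lambda>x. block_vec (f x) (g x)) has_derivative (\<lambda>h. block_vec (f' h) (g' h))) (at a)"
proof (rule has_derivative_vec)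
  fix i :: "'n + unit"
  show "((\<lambda>x. block_vec (f x) (g x) $ i) has_derivative (\<lambda>h. block_vec (f' h) (g' h) $ i)) (at a)"
    using assms bounded_linear.has_derivative[OF bounded_linear_vec_nth assms(1)]
    by (cases i) (auto simp: block_vec_def)
qed

text \<open>
  Analyticity on \<open>S\<close> yields a neighbourhood for each matrix entry separately; there are finitely
  many entries, so the neighbourhoods can be intersected. This supplies the open set on which
  \<open>mat_deriv M\<close> is again analytic, even when \<open>l\<close> lies on the boundary of \<open>S\<close>.
\<close>

lemma mat_analytic_on_nhd:
  assumes "mat_analytic_on M S" and "l \<in> S"
  obtains U where "open U" and "l \<in> U" and "mat_analytic_on M U"
proof -
  have "\<exists>T. open T \<and> l \<in> T \<and> (\<lambda>z. M z $ i $ j) holomorphic_on T" for i j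
    using assms analytic_on_analytic_at[of "\<lambda>z. M z $ i $ j" S]
    by (simp add: mat_analytic_on_def analytic_at)
  then obtain T where T: "\<And>i j. open (T i j) \<and> l \<in> T i j \<and> (\<lambda>z. M z $ i $ j) holomorphic_on T i j"
    by metis
  define U where "U = (\<Inter>i. \<Inter>j. T i j)"
  have "open U"
    unfolding U_def using T by (intro open_INT) auto
  moreover have "l \<in> U"
    unfolding U_def using T by simp
  moreover have "(\<lambda>z. M z $ i $ j) holomorphic_on U" for i j
    by (rule holomorphic_on_subset[of _ "T i j"]) (use T in \<open>auto simp: U_def\<close>)
  ultimately show thesis
    using that by (simp add: mat_analytic_on_def analytic_on_open)
qed

lemma mat_analytic_on_mat_deriv:
  assumes "mat_analytic_on M U" and "open U"
  shows "mat_analytic_on (mat_deriv M) U"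
  using assms by (auto simp: mat_analytic_on_def mat_deriv_def analytic_on_open intro: holomorphic_deriv)

lemma mat_analytic_on_has_derivative:
  fixes M :: "complex \<Rightarrow> complex^'n^'m"
  assumes "mat_analytic_on M S" and "l \<in> S"
  shows "(M has_derivative (\<lambda>h. \<chi> i j. mat_deriv M l $ i $ j * h)) (at l)"
proof (intro has_derivative_vec)
  fix i j
  have "(\<lambda>z. M z $ i $ j) field_differentiable at l"
    using assms unfolding mat_analytic_on_def
    by (meson analytic_on_imp_differentiable_at)
  then show "((\<lambda>z. M z $ i $ j) has_derivative
      (\<lambda>h. (\<chi> i j. mat_deriv M l $ i $ j * h) $ i $ j)) (at l)"
    by (simp add: mat_deriv_def has_field_derivative_def[symmetric] field_differentiable_derivI)
qed

text \<open>
  The product rule for \<open>M (\<mu> t) *v x t\<close>. All residuals below have this form, with \<open>M\<close> or its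
  derivative as the matrix family and with various choices of the curves \<open>\<mu>\<close> and \<open>x\<close>.
\<close>

lemma has_derivative_matrix_family:
  fixes M :: "complex \<Rightarrow> complex^'n^'m"
  assumes M: "mat_analytic_on M S" "\<mu> a \<in> S"
    and \<mu>: "(\<mu> has_derivative \<mu>') (at a)" and x: "(x has_derivative x') (at a)"
  shows "((\<lambda>t. M (\<mu> t) *v x t) has_derivative
    (\<lambda>h. M (\<mu> a) *v x' h + \<mu>' h *s (mat_deriv M (\<mu> a) *v x a))) (at a)"
proof -
  have "((\<lambda>t. M (\<mu> t)) has_derivative (\<lambda>h. \<chi> i j. mat_deriv M (\<mu> a) $ i $ j * \<mu>' h)) (at a)"
    using has_derivative_compose[OF \<mu> mat_analytic_on_has_derivative[OF M]] .
  from bounded_bilinear.FDERIV[OF bounded_bilinear_matrix_vector_mult this x]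
  have "((\<lambda>t. M (\<mu> t) *v x t) has_derivative (\<lambda>h. M (\<mu> a) *v x' h
      + (\<chi> i j. mat_deriv M (\<mu> a) $ i $ j * \<mu>' h) *v x a)) (at a)" .
  moreover have "(\<chi> i j. mat_deriv M (\<mu> a) $ i $ j * \<mu>' h) *v x a
      = \<mu>' h *s (mat_deriv M (\<mu> a) *v x a)" for h
    by (simp add: vec_eq_iff matrix_vector_mult_def sum_distrib_left algebra_simps)
  ultimately show ?thesis
    by simp
qed

lemma mat_analytic_on_continuous_on:
  fixes M :: "complex \<Rightarrow> complex^'n^'m"
  assumes "mat_analytic_on M U"
  shows "continuous_on U M"
  using mat_analytic_on_has_derivative[OF assms] has_derivative_continuous
  by (metis continuous_at_imp_continuous_on)

section \<open>Implicit functions\<close>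

text \<open>
  Each of the two functions tends to \<open>l\<close>, so the values of one eventually lie in the neighbourhood
  in which the other is the only solution.
\<close>

lemma solution_near_unique:
  assumes "solution_near P v l m" and "solution_near P v l m'"
  shows "\<forall>\<^sub>F x in nhds v. m' x = m x"
proof -
  obtain V where V: "open V" "l \<in> V"
      and sol: "\<forall>\<^sub>F x in nhds v. \<forall>\<mu>. \<mu> \<in> V \<and> P x \<mu> \<longleftrightarrow> \<mu> = m x"
    using assms(1) unfolding solution_near_def by blast
  obtain V' where sol': "\<forall>\<^sub>F x in nhds v. \<forall>\<mu>. \<mu> \<in> V' \<and> P x \<mu> \<longleftrightarrow> \<mu> = m' x"
    using assms(2) unfolding solution_near_def by blast
  have "\<forall>\<^sub>F x in nhds v. m' x \<in> V"
    using assms(2) V unfolding solution_near_def by (metis topological_tendstoD)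
  with sol sol' show ?thesis
    by eventually_elim blast
qed

text \<open>
  The implicit function theorem, obtained from the inverse function theorem for the map
  \<open>(x, \<mu>) \<mapsto> (x, F (x, \<mu>))\<close>, whose inverse \<open>g\<close> gives the solution as \<open>m x = snd (g (x, 0))\<close>. The
  derivative of \<open>m\<close> is described by the linearized equation that it satisfies, which leaves the
  inversion of the partial derivative in \<open>\<mu>\<close> to the application.
\<close>

lemma implicit_function:
  fixes F :: "'a::euclidean_space \<times> 'b::euclidean_space \<Rightarrow> 'b"
  assumes "open U" and "(v, l) \<in> U"
    and der: "\<And>z. z \<in> U \<Longrightarrow> (F has_derivative F' z) (at z)"
    and cont: "\<And>h. continuous_on U (\<lambda>z. F' z h)"
    and inj: "\<And>\<epsilon>. F' (v, l) (0, \<epsilon>) = 0 \<Longrightarrow> \<epsilon> = 0"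
    and zero: "F (v, l) = 0"
  obtains m m' where "solution_near (\<lambda>x \<mu>. F (x, \<mu>) = 0) v l m" and "m v = l"
    and "(m has_derivative m') (at v)" and "\<And>\<xi>. F' (v, l) (\<xi>, m' \<xi>) = 0"
proof -
  define \<Phi> where "\<Phi> = (\<lambda>z. (fst z, F z))"
  define \<Phi>' where "\<Phi>' = (\<lambda>z h. (fst h, F' z h))"
  have d\<Phi>: "(\<Phi> has_derivative \<Phi>' z) (at z)" if "z \<in> U" for z
    unfolding \<Phi>_def \<Phi>'_def
    by (intro has_derivative_Pair has_derivative_fst has_derivative_ident der that)
  have bl: "bounded_linear (\<Phi>' z)" if "z \<in> U" for z
    using d\<Phi>[OF that] by (rule has_derivative_bounded_linear)
  have lin: "linear (\<Phi>' (v, l))"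
    using bl \<open>(v, l) \<in> U\<close> bounded_linear.linear by blast
  have "inj (\<Phi>' (v, l))"
    unfolding linear_injective_0[OF lin] by (auto simp: \<Phi>'_def zero_prod_def inj)
  then obtain K where K: "linear K" "K \<circ> \<Phi>' (v, l) = id"
    using linear_injective_left_inverse[OF lin] by auto
  have inv: "Blinfun K o\<^sub>L Blinfun (\<Phi>' (v, l)) = id_blinfun"
    using K bl[OF \<open>(v, l) \<in> U\<close>]
    by (intro blinfun_eqI)
      (simp add: bounded_linear_Blinfun_apply linear_conv_bounded_linear pointfree_idE)
  have der': "(\<Phi> has_derivative blinfun_apply (Blinfun (\<Phi>' z))) (at z)" if "z \<in> U" for z
    using d\<Phi>[OF that] bl[OF that] by (simp add: bounded_linear_Blinfun_apply)
  have cont': "continuous_on U (\<lambda>z. Blinfun (\<Phi>' z))"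
  proof (rule continuous_on_blinfun_componentwise)
    fix i :: "'a \<times> 'b"
    have "continuous_on U (\<lambda>z. \<Phi>' z i)"
      unfolding \<Phi>'_def by (intro continuous_intros cont)
    then show "continuous_on U (\<lambda>z. blinfun_apply (Blinfun (\<Phi>' z)) i)"
      by (rule continuous_on_eq) (simp add: bl bounded_linear_Blinfun_apply)
  qed
  obtain W Y g g' where W: "open W" "W \<subseteq> U" "(v, l) \<in> W"
      and Y: "open Y" "\<Phi> (v, l) \<in> Y" and hom: "homeomorphism W Y \<Phi> g"
      and dg: "\<And>y. y \<in> Y \<Longrightarrow> (g has_derivative g' y) (at y)"
      and g': "\<And>y. y \<in> Y \<Longrightarrow> g' y = Hilbert_Choice.inv (blinfun_apply (Blinfun (\<Phi>' (g y))))"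
      and bij: "\<And>y. y \<in> Y \<Longrightarrow> bij (blinfun_apply (Blinfun (\<Phi>' (g y))))"
    using inverse_function_theorem[OF \<open>open U\<close> der' cont' \<open>(v, l) \<in> U\<close> inv] by blast
  define m where "m x = snd (g (x, 0))" for x
  define m' where "m' \<xi> = snd (g' (v, 0) (\<xi>, 0))" for \<xi>
  have \<Phi>v: "\<Phi> (v, l) = (v, 0)"
    by (simp add: \<Phi>_def zero)
  have gv: "g (v, 0) = (v, l)"
    using hom W(3) \<Phi>v by (metis homeomorphism_apply1)
  have vY: "(v, 0) \<in> Y"
    using Y \<Phi>v by simp
  have dm: "(m has_derivative m') (at v)"
  proof -
    have "((\<lambda>x. (x, 0 :: 'b)) has_derivative (\<lambda>\<xi>. (\<xi>, 0))) (at v)"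
      by (intro has_derivative_Pair has_derivative_ident has_derivative_const)
    from has_derivative_compose[OF this, of g "g' (v, 0)"] dg[OF vY] show ?thesis
      unfolding m_def[abs_def] m'_def[abs_def] by (intro has_derivative_snd) simp
  qed
  have "F' (v, l) (\<xi>, m' \<xi>) = 0" for \<xi>
  proof -
    have "\<Phi>' (v, l) (g' (v, 0) (\<xi>, 0)) = (\<xi>, 0)"
      using g'[OF vY] bij[OF vY] bl[OF \<open>(v, l) \<in> U\<close>]
      by (simp add: gv bounded_linear_Blinfun_apply bij_is_surj surj_f_inv_f)
    then show ?thesis
      unfolding \<Phi>'_def m'_def by (metis prod.collapse fst_conv snd_conv)
  qed
  moreover have "solution_near (\<lambda>x \<mu>. F (x, \<mu>) = 0) v l m"
  proof -
    have mv: "m v = l"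
      by (simp add: m_def gv)
    have lim: "(m \<longlongrightarrow> l) (nhds v)"
      using has_derivative_continuous[OF dm] mv tendsto_at_iff_tendsto_nhds[of m v]
      by (simp add: continuous_at)
    \<comment> \<open>The inverse is unique only inside \<open>W\<close>; a box in \<open>W\<close> separates the condition on \<open>x\<close> from that on \<open>\<mu>\<close>.\<close>
    obtain A V where "open A" "open V" "(v, l) \<in> A \<times> V" "A \<times> V \<subseteq> W"
      by (rule open_prod_elim[OF W(1,3)])
    then have AV: "open A" "open V" "v \<in> A" "l \<in> V" "A \<times> V \<subseteq> W"
      by auto
    have "((\<lambda>x. (x, 0 :: 'b)) \<longlongrightarrow> (v, 0)) (nhds v)"
      by (intro tendsto_intros filterlim_ident)
    then have "\<forall>\<^sub>F x in nhds v. (x, 0) \<in> Y"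
      using Y(1) vY by (rule topological_tendstoD)
    moreover have "\<forall>\<^sub>F x in nhds v. m x \<in> V"
      using lim AV(2,4) by (rule topological_tendstoD)
    moreover have "\<forall>\<^sub>F x in nhds v. x \<in> A"
      using AV by (simp add: eventually_nhds_in_open)
    ultimately have "\<forall>\<^sub>F x in nhds v. \<forall>\<mu>. \<mu> \<in> V \<and> F (x, \<mu>) = 0 \<longleftrightarrow> \<mu> = m x"
    proof eventually_elim
      case (elim x)
      show ?case
      proof (intro allI iffI)
        fix \<mu> assume "\<mu> \<in> V \<and> F (x, \<mu>) = 0"
        then have "(x, \<mu>) \<in> W" "\<Phi> (x, \<mu>) = (x, 0)"
          using AV elim by (auto simp: \<Phi>_def)
        then have "g (x, 0) = (x, \<mu>)"
          using hom by (metis homeomorphism_apply1)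
        then show "\<mu> = m x"
          by (simp add: m_def)
      next
        fix \<mu> assume "\<mu> = m x"
        moreover have "\<Phi> (g (x, 0)) = (x, 0)"
          using hom elim by (metis homeomorphism_apply2)
        then have "F (x, m x) = 0"
          unfolding \<Phi>_def m_def by (metis prod.collapse fst_conv snd_conv)
        ultimately show "\<mu> \<in> V \<and> F (x, \<mu>) = 0"
          using elim by simp
      qed
    qed
    with lim AV show ?thesis
      unfolding solution_near_def by blast
  qed
  ultimately show thesis
    using that dm gv by (simp add: m_def)
qed

section \<open>Convergence factors\<close>

text \<open>
  Fixed points and derivatives depend only on the germ of a map at \<open>p\<close>, so it suffices to treat one
  map that realises the iteration and to know that every other one agrees with it near \<open>p\<close>.
\<close>

lemma has_convergence_factor_by_representative:
  assumes "is_map G0" and "G0 p = p" and "(G0 has_derivative (\<lambda>h. A *v h)) (at p)"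
    and same: "\<And>G. is_map G \<Longrightarrow> \<forall>\<^sub>F x in nhds p. G x = G0 x"
  shows "has_convergence_factor is_map p (spectral_radius A)"
  unfolding has_convergence_factor_def
proof (intro conjI allI impI)
  fix G assume "is_map G"
  then have ev: "\<forall>\<^sub>F x in nhds p. G0 x = G x" and Gp: "G p = G0 p"
    using same[THEN eventually_mono] eventually_nhds_x_imp_x[OF same] by auto
  show "G p = p"
    using Gp assms(2) by simp
  have "(G has_derivative (\<lambda>h. A *v h)) (at p)"
    using assms(3) ev Gp by (auto intro!: has_derivative_transform_eventually[OF assms(3)]
        filter_leD[OF at_within_le_nhds])
  then show "\<exists>A'. (G has_derivative (\<lambda>h. A' *v h)) (at p) \<and> spectral_radius A = spectral_radius A'"
    by blast
qed (use assms(1) in blast)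

text \<open>
  Eliminating \<open>x' - x\<close> from the first block row and inserting it into the second gives the increment
  \<open>\<mu>' - \<mu> = e\<close> with \<open>e = (r x - 1 - w M(\<mu>) x) / (w M'(\<mu>) x)\<close>, and then
  \<open>x' = x - N (M(\<mu>) x + e M'(\<mu>) x)\<close>. At the solution \<open>e\<close> vanishes, so the derivative of
  \<open>M'(\<mu>) x\<close> and that of the denominator drop out. In the direction \<open>(\<xi>, \<epsilon>)\<close> the derivative of \<open>e\<close>
  is \<open>\<alpha> (r \<xi> - w M(l) \<xi>) - \<epsilon>\<close>; its last term cancels the dependence of the step on \<open>\<epsilon>\<close>, which is
  the reason for the zero column in the matrix.
\<close>

lemma qn2_convergence_factor:
  fixes M :: "complex \<Rightarrow> complex^'n^'n"
  assumes M: "mat_analytic_on M S" and lS: "l \<in> S"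
    and v: "M l *v v = 0" and rv: "row_col (herm c) v = 1" and inv: "invertible (M \<sigma>)"
    and a: "row_col (w_row M c \<sigma>) (mat_deriv M l *v v) \<noteq> 0"
  defines "\<alpha> \<equiv> inverse (row_col (w_row M c \<sigma>) (mat_deriv M l *v v))"
  defines "q \<equiv> matrix_inv (M \<sigma>) *v (mat_deriv M l *v v)"
  shows "has_convergence_factor (qn2_map M c \<sigma> l v) (block_vec v l)
    (spectral_radius (block_mat
      ((mat 1 - outer (\<alpha> *s q) (herm c)) ** matrix_inv (M \<sigma>) ** (M \<sigma> - M l))
      0
      (\<alpha> *s (herm c v* (matrix_inv (M \<sigma>) ** (M \<sigma> - M l))))
      0))"
    (is "has_convergence_factor _ _ (spectral_radius ?A2)")
proof -
  define N where "N = matrix_inv (M \<sigma>)"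
  define r where "r = herm c"
  define w where "w = w_row M c \<sigma>"
  define D where "D = mat_deriv M"
  define p where "p = block_vec v l"
  have w: "row_col w x = row_col r (N *v x)" for x
    by (simp add: w_def w_row_def r_def N_def row_col_vector_matrix)
  have cancel: "N *v (M \<sigma> *v x) = x" "M \<sigma> *v (N *v x) = x" for x
    using inv by (simp_all add: N_def matrix_inv_mult_cancel)
  obtain U where U: "open U" "l \<in> U" "mat_analytic_on M U"
    using mat_analytic_on_nhd[OF M lS] by blast
  then have U': "mat_analytic_on D U"
    by (simp add: D_def mat_analytic_on_mat_deriv)
  \<comment> \<open>Numerator, denominator and value of the increment of \<open>\<mu>\<close>, as functions of the block vector.\<close>
  define n where "n z = row_col r (top_part z) - 1 - row_col w (M (bot_part z) *v top_part z)" for z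
  define d where "d z = row_col w (D (bot_part z) *v top_part z)" for z
  define e where "e z = n z / d z" for z
  define G where "G z = block_vec
    (top_part z - N *v (M (bot_part z) *v top_part z + e z *s (D (bot_part z) *v top_part z)))
    (bot_part z + e z)" for z
  have dtop: "(top_part has_derivative top_part) (at p)"
    and dbot: "(bot_part has_derivative bot_part) (at p)"
    using bounded_linear_imp_has_derivative bounded_linear_top_part bounded_linear_bot_part by blast+
  have p: "top_part p = v" "bot_part p = l"
    by (simp_all add: p_def)
  note dM = has_derivative_matrix_family[OF U(3) _ dbot dtop, unfolded p, OF U(2), folded D_def]
  note dD = has_derivative_matrix_family[OF U' _ dbot dtop, unfolded p, OF U(2)]
  note drow = bounded_linear.has_derivative[OF bounded_linear_row_col]
  have dn: "(n has_derivative (\<lambda>h. row_col r (top_part h)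
      - row_col w (M l *v top_part h + bot_part h *s (D l *v v)))) (at p)"
    unfolding n_def[abs_def] by (auto intro!: derivative_eq_intros drow[OF dtop] drow[OF dM])
  have dd: "(d has_derivative
      (\<lambda>h. row_col w (D l *v top_part h + bot_part h *s (mat_deriv D l *v v)))) (at p)"
    unfolding d_def[abs_def] by (rule drow[OF dD])
  have n0: "n p = 0"
    by (simp add: n_def p v rv r_def row_col_linear)
  have e0: "e p = 0"
    by (simp add: e_def n0)
  have dp: "d p = inverse \<alpha>" "d p \<noteq> 0" "\<alpha> \<noteq> 0"
    using a by (simp_all add: d_def p \<alpha>_def w_def D_def)
  have de: "(e has_derivative (\<lambda>h. \<alpha> * (row_col r (top_part h)
      - row_col w (M l *v top_part h)) - bot_part h)) (at p)"
  proof -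
    have "(e has_derivative (\<lambda>h. (row_col r (top_part h)
      - row_col w (M l *v top_part h + bot_part h *s (D l *v v))) / d p)) (at p)"
      unfolding e_def[abs_def]
      by (rule has_derivative_eq_rhs[OF has_derivative_divide'[OF dn dd dp(2)]])
        (use dp n0 in \<open>simp add: field_simps fun_eq_iff\<close>)
    then show ?thesis
    proof (rule has_derivative_eq_rhs)
      have "row_col w (D l *v v) = inverse \<alpha>"
        using dp(1) by (simp add: d_def p)
      then show "(\<lambda>h. (row_col r (top_part h)
          - row_col w (M l *v top_part h + bot_part h *s (D l *v v))) / d p)
        = (\<lambda>h. \<alpha> * (row_col r (top_part h) - row_col w (M l *v top_part h)) - bot_part h)"
        unfolding dp(1) using dp(3)
        by (simp add: fun_eq_iff row_col_add row_col_scale[of w "bot_part _"] field_simps)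
    qed
  qed
  have dG: "(G has_derivative (\<lambda>h :: complex^('n + unit). block_vec
     (top_part h - N *v (M l *v top_part h + bot_part h *s (D l *v v)
        + (\<alpha> * (row_col r (top_part h) - row_col w (M l *v top_part h)) - bot_part h) *s (D l *v v)))
     (bot_part h + (\<alpha> * (row_col r (top_part h) - row_col w (M l *v top_part h)) - bot_part h)))) (at p)"
    unfolding G_def[abs_def]
    apply (rule has_derivative_block_vec)
     apply (rule has_derivative_diff[OF dtop])
     apply (rule bounded_linear.has_derivative[OF matrix_vector_mul_bounded_linear])
     apply (rule has_derivative_add[OF dM])
     apply (rule has_derivative_eq_rhs[OF
           bounded_bilinear.FDERIV[OF bounded_bilinear_vector_scale de dD]])
     apply (simp add: e0 p)
    apply (rule has_derivative_add[OF dbot de])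
    done
  have A2: "(\<lambda>h :: complex^('n + unit). block_vec
     (top_part h - N *v (M l *v top_part h + bot_part h *s (D l *v v)
        + (\<alpha> * (row_col r (top_part h) - row_col w (M l *v top_part h)) - bot_part h) *s (D l *v v)))
     (bot_part h + (\<alpha> * (row_col r (top_part h) - row_col w (M l *v top_part h)) - bot_part h)))
     = (\<lambda>h. ?A2 *v h)"
  proof
    fix h :: "complex^('n + unit)"
    obtain x b where h: "h = block_vec x b"
      by (metis block_vec_parts)
    show "block_vec
     (top_part h - N *v (M l *v top_part h + bot_part h *s (D l *v v)
        + (\<alpha> * (row_col r (top_part h) - row_col w (M l *v top_part h)) - bot_part h) *s (D l *v v)))
     (bot_part h + (\<alpha> * (row_col r (top_part h) - row_col w (M l *v top_part h)) - bot_part h))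
     = ?A2 *v h"
      unfolding N_def[symmetric] r_def[symmetric] q_def D_def[symmetric]
      by (simp add: h block_mat_mult_block_vec block_vec_eq_iff matrix_vector_mul_assoc[symmetric]
          row_col_left_scale row_col_vector_matrix w cancel outer_vector_mult row_col_linear
          matrix_vector_mult_scale matrix_vector_mult_diff_rdistrib matrix_vector_mult_diff_distrib
          matrix_vector_right_distrib vec_eq_iff algebra_simps)
  qed
  have step: "qn2_step M c \<sigma> (top_part z) (bot_part z) (top_part z') (bot_part z') \<longleftrightarrow> z' = G z"
    if dz: "d z \<noteq> 0" for z z'
  proof -
    define x \<mu> x' \<mu>' where defs: "x = top_part z" "\<mu> = bot_part z" "x' = top_part z'" "\<mu>' = bot_part z'"
    have "qn2_step M c \<sigma> x \<mu> x' \<mu>' \<longleftrightarrow>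
        M \<sigma> *v (x' - x) + (\<mu>' - \<mu>) *s (D \<mu> *v x) = - (M \<mu> *v x) \<and>
        row_col r (x' - x) = - (row_col r x - 1)"
      by (simp add: qn2_step_def block_mat_mult_block_vec block_vec_minus block_vec_eq_iff
          D_def r_def)
    also have "\<dots> \<longleftrightarrow> x' = x - N *v (M \<mu> *v x + (\<mu>' - \<mu>) *s (D \<mu> *v x)) \<and> \<mu>' = \<mu> + e z"
      (is "?l1 \<and> ?l2 \<longleftrightarrow> ?r1 \<and> ?r2")
    proof -
      \<comment> \<open>The first block row determines \<open>x'\<close> from \<open>\<mu>'\<close>; the second then becomes a scalar equation for \<open>\<mu>'\<close>.\<close>
      have 1: "?l1 \<longleftrightarrow> ?r1"
      proof
        assume ?l1
        then have "M \<sigma> *v (x' - x) = - (M \<mu> *v x + (\<mu>' - \<mu>) *s (D \<mu> *v x))"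
          by (simp add: algebra_simps eq_neg_iff_add_eq_0)
        then have "N *v (M \<sigma> *v (x' - x)) = - (N *v (M \<mu> *v x + (\<mu>' - \<mu>) *s (D \<mu> *v x)))"
          by (metis matrix_vector_mult_diff_distrib diff_0 matrix_vector_mult_0_right)
        then show ?r1
          by (simp add: cancel algebra_simps)
      next
        assume ?r1
        then have "x' - x = - (N *v (M \<mu> *v x + (\<mu>' - \<mu>) *s (D \<mu> *v x)))"
          by simp
        then have "M \<sigma> *v (x' - x) = - (M \<mu> *v x + (\<mu>' - \<mu>) *s (D \<mu> *v x))"
          by (metis cancel(2) matrix_vector_mult_diff_distrib diff_0 matrix_vector_mult_0_right)
        then show ?l1
          by (simp add: algebra_simps)
      qed
      moreover have "?l2 \<longleftrightarrow> ?r2" if ?r1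
      proof -
        have "row_col r (N *v (M \<mu> *v x + t *s (D \<mu> *v x))) = row_col w (M \<mu> *v x) + t * d z" for t
          by (simp add: w d_def defs row_col_linear matrix_vector_right_distrib
              matrix_vector_mult_scale)
        moreover have "x' - x = - (N *v (M \<mu> *v x + (\<mu>' - \<mu>) *s (D \<mu> *v x)))"
          unfolding that by simp
        ultimately have "row_col r (x' - x) = - (row_col w (M \<mu> *v x) + (\<mu>' - \<mu>) * d z)"
          by (simp only: row_col_minus)
        then have "?l2 \<longleftrightarrow> row_col w (M \<mu> *v x) + (\<mu>' - \<mu>) * d z = row_col r x - 1"
          by (simp only: neg_equal_iff_equal)
        also have "\<dots> \<longleftrightarrow> (\<mu>' - \<mu>) * d z = n z"
          unfolding n_def defs by (metis add.commute eq_diff_eq)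
        also have "\<dots> \<longleftrightarrow> ?r2"
          using dz by (auto simp: e_def field_simps)
        finally show ?thesis .
      qed
      ultimately show ?thesis
        by blast
    qed
    also have "\<dots> \<longleftrightarrow> block_vec x' \<mu>' = G z"
      by (auto simp: G_def block_vec_eq_iff defs[symmetric])
    finally show ?thesis
      by (simp add: defs)
  qed
  have ev: "\<forall>\<^sub>F z in nhds p. d z \<noteq> 0"
    using has_derivative_continuous[OF dd] dp(2)
    by (metis continuous_at tendsto_at_iff_tendsto_nhds tendsto_imp_eventually_ne)
  show ?thesis
  proof (rule has_convergence_factor_by_representative)
    show "qn2_map M c \<sigma> l v G"
      unfolding qn2_map_def p_def[symmetric] using ev
      by eventually_elim (use step in blast)
    show "G (block_vec v l) = block_vec v l"
      unfolding p_def[symmetric] G_def p e0 by (simp add: v p_def)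
    show "(G has_derivative (\<lambda>h. ?A2 *v h)) (at (block_vec v l))"
      using dG unfolding A2 p_def .
    fix G' assume "qn2_map M c \<sigma> l v G'"
    then have "\<forall>\<^sub>F z in nhds p. \<forall>z'. qn2_step M c \<sigma> (top_part z) (bot_part z) (top_part z') (bot_part z')
        \<longleftrightarrow> z' = G' z"
      by (simp add: qn2_map_def p_def)
    with ev show "\<forall>\<^sub>F z in nhds (block_vec v l). G' z = G z"
      unfolding p_def[symmetric] by eventually_elim (use step in blast)
  qed
qed

text \<open>
  Linearizing \<open>w M(m x) x = 0\<close> at \<open>v\<close> gives \<open>m' \<xi> = - w M(l) \<xi> / (w M'(l) v)\<close>. The unnormalized
  step \<open>X x = x - N M(m x) x\<close> fixes \<open>v\<close>, where \<open>r X = 1\<close>, so by the quotient rule the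
  normalized step has the derivative \<open>X' \<xi> - (r X' \<xi>) v = (I - v r) X' \<xi>\<close>.
\<close>

lemma qn3_convergence_factor:
  fixes M :: "complex \<Rightarrow> complex^'n^'n"
  assumes M: "mat_analytic_on M S" and lS: "l \<in> S"
    and v: "M l *v v = 0" and rv: "row_col (herm c) v = 1" and inv: "invertible (M \<sigma>)"
    and a: "row_col (w_row M c \<sigma>) (mat_deriv M l *v v) \<noteq> 0"
  defines "w \<equiv> w_row M c \<sigma>"
  shows "has_convergence_factor (qn3_map M c \<sigma> l v) v
    (spectral_radius ((mat 1 - outer v (herm c)) ** matrix_inv (M \<sigma>) **
      (M \<sigma> - M l
        + outer ((1 / row_col w (mat_deriv M l *v v)) *s (mat_deriv M l *v v)) w ** M l)))"
    (is "has_convergence_factor _ _ (spectral_radius ?B)")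
proof -
  define N where "N = matrix_inv (M \<sigma>)"
  define r where "r = herm c"
  define D where "D = mat_deriv M"
  define a where "a = row_col w (D l *v v)"
  have a0: "a \<noteq> 0"
    using assms(6) by (simp add: a_def w_def D_def)
  have cancel: "N *v (M \<sigma> *v x) = x" for x
    using inv by (simp add: N_def matrix_inv_mult_cancel)
  obtain U where U: "open U" "l \<in> U" "mat_analytic_on M U"
    using mat_analytic_on_nhd[OF M lS] by blast
  then have U': "mat_analytic_on D U"
    by (simp add: D_def mat_analytic_on_mat_deriv)
  note drow = bounded_linear.has_derivative[OF bounded_linear_row_col]
  define P where "P = (\<lambda>x \<mu>. row_col w (M \<mu> *v x) = 0)"
  obtain m m' where m: "solution_near P v l m" "m v = l" "(m has_derivative m') (at v)"
      and m': "\<And>\<xi>. row_col w (M l *v \<xi> + m' \<xi> *s (D l *v v)) = 0"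
  proof -
    define F where "F = (\<lambda>z. row_col w (M (snd z) *v fst z))"
    define F' where "F' = (\<lambda>z h. row_col w (M (snd z) *v fst h + snd h *s (D (snd z) *v fst z)))"
    have der: "(F has_derivative F' z) (at z)" if "z \<in> UNIV \<times> U" for z
      unfolding F_def F'_def D_def using that
      by (intro drow has_derivative_matrix_family[OF U(3)])
        (auto intro!: derivative_eq_intros)
    have cont: "continuous_on (UNIV \<times> U) (\<lambda>z. F' z h)" for h
      unfolding F'_def
      by (intro bounded_linear.continuous_on[OF bounded_linear_row_col]
          bounded_bilinear.continuous_on[OF bounded_bilinear_matrix_vector_mult]
          bounded_bilinear.continuous_on[OF bounded_bilinear_vector_scale]
          continuous_on_compose2[OF mat_analytic_on_continuous_on[OF U(3)]]
          continuous_on_compose2[OF mat_analytic_on_continuous_on[OF U']]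
          continuous_intros) auto
    have inj: "\<epsilon> = 0" if "F' (v, l) (0, \<epsilon>) = 0" for \<epsilon>
      using that a0 by (simp add: F'_def a_def row_col_linear)
    obtain m m' where "solution_near (\<lambda>x \<mu>. F (x, \<mu>) = 0) v l m" "m v = l"
        "(m has_derivative m') (at v)" "\<And>\<xi>. F' (v, l) (\<xi>, m' \<xi>) = 0"
      by (rule implicit_function[of "UNIV \<times> U" v l F F'])
        (use U der cont inj in \<open>auto simp: open_Times F_def v row_col_linear\<close>)
    then show thesis
      using that by (simp add: F_def F'_def P_def)
  qed
  have m'_eq: "m' \<xi> = - row_col w (M l *v \<xi>) / a" for \<xi>
    using m'[of \<xi>] a0 by (simp add: row_col_linear a_def field_simps eq_neg_iff_add_eq_0)
  define X where "X x = x - N *v (M (m x) *v x)" for x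
  define G where "G x = (1 / row_col r (X x)) *s X x" for x
  define X' where "X' \<xi> = \<xi> - N *v (M l *v \<xi> + m' \<xi> *s (D l *v v))" for \<xi>
  have dX: "(X has_derivative X') (at v)"
    unfolding X_def[abs_def] X'_def[abs_def] D_def m(2)[symmetric]
    by (intro has_derivative_diff has_derivative_ident
        bounded_linear.has_derivative[OF matrix_vector_mul_bounded_linear]
        has_derivative_matrix_family[OF U(3) _ m(3)])
      (simp add: m(2) U)
  have Xv: "X v = v"
    by (simp add: X_def m(2) v)
  have rX: "row_col r (X v) = 1"
    using rv by (simp add: Xv r_def)
  have dr: "((\<lambda>x. 1 / row_col r (X x)) has_derivative (\<lambda>\<xi>. - row_col r (X' \<xi>))) (at v)"
    by (rule has_derivative_eq_rhs[OF
          has_derivative_divide'[OF has_derivative_const drow[OF dX]]])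
      (simp_all add: rX)
  have dG: "(G has_derivative (\<lambda>\<xi>. X' \<xi> - row_col r (X' \<xi>) *s v)) (at v)"
    unfolding G_def[abs_def]
    by (rule has_derivative_eq_rhs[OF bounded_bilinear.FDERIV[OF bounded_bilinear_vector_scale dr dX]])
      (use rX in \<open>simp add: Xv fun_eq_iff vec_eq_iff\<close>)
  have B: "(\<lambda>\<xi>. X' \<xi> - row_col r (X' \<xi>) *s v) = (\<lambda>\<xi>. ?B *v \<xi>)"
  proof
    fix \<xi>
    have "X' \<xi> = N *v ((M \<sigma> - M l + outer ((1 / a) *s (D l *v v)) w ** M l) *v \<xi>)"
      by (simp add: X'_def m'_eq cancel matrix_vector_mul_assoc[symmetric]
          outer_vector_mult matrix_vector_mult_scale matrix_vector_mult_diff_rdistrib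
          matrix_vector_mult_add_rdistrib matrix_vector_mult_diff_distrib
          matrix_vector_right_distrib vec_eq_iff)
    then show "X' \<xi> - row_col r (X' \<xi>) *s v = ?B *v \<xi>"
      unfolding N_def[symmetric] r_def[symmetric] D_def[symmetric] a_def[symmetric]
      by (simp add: matrix_vector_mul_assoc[symmetric] matrix_vector_mult_diff_rdistrib
          outer_vector_mult)
  qed
  show ?thesis
  proof (rule has_convergence_factor_by_representative)
    show "qn3_map M c \<sigma> l v G"
      unfolding qn3_map_def using m(1)
      by (auto simp: P_def w_def G_def X_def N_def r_def Let_def)
    show "G v = v"
      using rX by (simp add: G_def Xv)
    show "(G has_derivative (\<lambda>\<xi>. ?B *v \<xi>)) (at v)"
      using dG unfolding B .
    fix G' assume "qn3_map M c \<sigma> l v G'"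
    then have "\<exists>k. solution_near P v l k \<and>
        (\<forall>\<^sub>F x in nhds v. let xh = x - N *v (M (k x) *v x) in G' x = (1 / row_col r xh) *s xh)"
      unfolding qn3_map_def P_def w_def N_def r_def .
    then obtain k where k: "solution_near P v l k \<and>
        (\<forall>\<^sub>F x in nhds v. let xh = x - N *v (M (k x) *v x) in G' x = (1 / row_col r xh) *s xh)"
      by (rule exE)
    from solution_near_unique[OF m(1) k[THEN conjunct1]] k[THEN conjunct2]
    show "\<forall>\<^sub>F x in nhds v. G' x = G x"
      by eventually_elim (simp add: G_def X_def Let_def)
  qed
qed

theorem corollary3p3:
  fixes \<Omega> :: "complex set" and M :: "complex \<Rightarrow> complex^'n^'n"
    and c v :: "complex^'n" and l \<sigma> :: complex
  defines "w \<equiv> w_row M c \<sigma>"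
  defines "\<alpha> \<equiv> inverse (row_col w (mat_deriv M l *v v))"
  defines "q \<equiv> matrix_inv (M \<sigma>) *v (mat_deriv M l *v v)"
  defines "A2 \<equiv> block_mat
      ((mat 1 - outer (\<alpha> *s q) (herm c)) ** matrix_inv (M \<sigma>) ** (M \<sigma> - M l))
      0
      (\<alpha> *s (herm c v* (matrix_inv (M \<sigma>) ** (M \<sigma> - M l))))
      0"
  defines "B \<equiv> (mat 1 - outer v (herm c)) ** matrix_inv (M \<sigma>) **
      (M \<sigma> - M l
        + outer ((1 / row_col w (mat_deriv M l *v v)) *s (mat_deriv M l *v v)) w ** M l)"
  assumes "closed \<Omega>"
    and "mat_analytic_on M \<Omega>"
    and "eigenpair \<Omega> M l v"
    and "row_col (herm c) v = 1"
    and "\<sigma> \<in> \<Omega>"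
    and "invertible (M \<sigma>)"
    and "row_col w (mat_deriv M l *v v) \<noteq> 0"
  shows "{z. z \<noteq> 0 \<and> eigenvalue A2 z} = {z. z \<noteq> 0 \<and> eigenvalue B z}
    \<and> (\<exists>\<rho>. has_convergence_factor (qn2_map M c \<sigma> l v) (block_vec v l) \<rho>
          \<and> has_convergence_factor (qn3_map M c \<sigma> l v) v \<rho>)"
proof -
  define N where "N = matrix_inv (M \<sigma>)"
  define r where "r = herm c"
  define D where "D = mat 1 - N ** M l + outer (\<alpha> *s q) (w v* M l)"
  have l: "l \<in> \<Omega>" "v \<noteq> 0" "M l *v v = 0"
    using \<open>eigenpair \<Omega> M l v\<close> by (auto simp: eigenpair_def)
  have rv: "row_col r v = 1"
    using \<open>row_col (herm c) v = 1\<close> by (simp add: r_def)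
  have cancel: "N *v (M \<sigma> *v x) = x" for x
    using \<open>invertible (M \<sigma>)\<close> by (simp add: N_def matrix_inv_mult_cancel)
  have w: "row_col w x = row_col r (N *v x)" for x
    by (simp add: w_def w_row_def r_def N_def row_col_vector_matrix)
  have rq: "row_col r (\<alpha> *s q) = 1"
    using \<open>row_col w (mat_deriv M l *v v) \<noteq> 0\<close>
    by (simp add: row_col_linear \<alpha>_def q_def w N_def)
  have Dx: "D *v x = x - N *v (M l *v x) + row_col w (M l *v x) *s (\<alpha> *s q)" for x
    by (simp add: D_def matrix_vector_mult_add_rdistrib matrix_vector_mult_diff_rdistrib
        outer_vector_mult row_col_vector_matrix matrix_vector_mul_assoc)
  \<comment> \<open>\<open>r D = r - w M(l) + (r (\<alpha> q)) w M(l)\<close>, and the last two terms cancel.\<close>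
  have rD: "r v* D = r"
  proof -
    have "row_col (r v* D) x = row_col r x" for x
      using rq by (simp add: row_col_vector_matrix Dx row_col_linear w)
    then have "row_col (r v* D) (axis i 1) = row_col r (axis i 1)" for i
      by blast
    then show ?thesis
      by (simp add: row_col_def axis_def vec_eq_iff if_distrib cong: if_cong)
  qed
  have B: "B = D - outer v r"
  proof -
    have "row_col r (D *v x) = row_col r x" for x
      using rD by (metis row_col_vector_matrix)
    moreover have "B *v x = D *v x - row_col r (D *v x) *s v" for x
    proof -
      have "D *v x = N *v ((M \<sigma> - M l
          + outer ((1 / row_col w (mat_deriv M l *v v)) *s (mat_deriv M l *v v)) w ** M l) *v x)"
        by (simp add: Dx cancel \<alpha>_def q_def N_def[symmetric] matrix_vector_mul_assoc[symmetric]
          outer_vector_mult matrix_vector_mult_scale matrix_vector_mult_diff_rdistrib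
          matrix_vector_mult_add_rdistrib matrix_vector_mult_diff_distrib
          matrix_vector_right_distrib vec_eq_iff field_simps)
      then show ?thesis
        unfolding B_def N_def[symmetric] r_def[symmetric]
        by (simp add: matrix_vector_mul_assoc[symmetric] matrix_vector_mult_diff_rdistrib
          outer_vector_mult)
    qed
    \<comment> \<open>By construction \<open>B = (I - v r) D\<close>, which is \<open>D - v r\<close> because \<open>r D = r\<close>.\<close>
    ultimately show ?thesis
      by (simp add: matrix_eq matrix_vector_mult_diff_rdistrib outer_vector_mult)
  qed
  have T: "(mat 1 - outer (\<alpha> *s q) (herm c)) ** matrix_inv (M \<sigma>) ** (M \<sigma> - M l)
      = D - outer (\<alpha> *s q) r"
    unfolding N_def[symmetric] r_def[symmetric]
    by (simp add: matrix_eq matrix_vector_mul_assoc[symmetric] Dx w cancel outer_vector_mult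
        row_col_linear matrix_vector_mult_diff_rdistrib matrix_vector_mult_diff_distrib
        vec_eq_iff algebra_simps)
  have nonzero: "eigenvalue A2 z \<longleftrightarrow> eigenvalue B z" if "z \<noteq> 0" for z
    using eigenvalue_deflation[OF rD rq rv that]
    by (simp add: A2_def T B eigenvalue_block_lower[OF that])
  \<comment> \<open>The eigenvalue 0 belongs to both spectra, so that the two maxima range over the same set.\<close>
  have "B *v v = 0 *s v"
    by (simp add: B matrix_vector_mult_diff_rdistrib outer_vector_mult Dx l rv row_col_linear)
  then have "eigenvalue A2 z \<longleftrightarrow> eigenvalue B z" for z
    using nonzero[of z] eigenvalue_block_last_column_zero l(2) unfolding A2_def
    by (cases "z = 0") (auto simp: eigenvalue_def)
  then have "spectral_radius A2 = spectral_radius B"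
    by (simp add: spectral_radius_def)
  moreover have "has_convergence_factor (qn2_map M c \<sigma> l v) (block_vec v l) (spectral_radius A2)"
    unfolding A2_def \<alpha>_def q_def w_def
    using qn2_convergence_factor assms l unfolding w_def by blast
  moreover have "has_convergence_factor (qn3_map M c \<sigma> l v) v (spectral_radius B)"
    unfolding B_def w_def
    using qn3_convergence_factor assms l unfolding w_def by blast
  ultimately show ?thesis
    using nonzero by auto
qed

end
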